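(* (Dieudonné's lemma) Let $(S,\lhd)$ be a proximity $\mathbf{ba\ell}$-algebra and let $D$ be the Dedekind completion of $S$, such that $S$ is uniformly dense in $D$. Then the closure $\lhd'$ of $\lhd$ in $D\times D$ is a KT-proximity on $D$, and hence $(D,\lhd')$ is a KT-algebra.
   Context: All algebras are commutative and unital. An $\ell$-algebra is an $\mathbb R$-algebra $A$ that is also a lattice such that: $a\le b$ implies $a+c\le b+c$; $0\le a,b$ implies $0\le ab$; $0\le a$ and $0\le r\in\mathbb R$ imply $0\le ra$. It is bounded if for each $a\in A$ there is an integer $n\ge1$ with $a\le n\cdot 1$; it is archimedean if whenever $na\le b$ for all integers $n\ge1$, then $a\le0$. A $\mathbf{ba\ell}$-algebra is a bounded archimedean $\ell$-algebra; a $\mathbf{ba\ell}$-morphism is a unital $\ell$-algebra homomorphism. Real numbers $r$ are identified with $r\cdot1\in A$. Put $|a|=a\vee(-a)$ and $\|a\|=\inf\{r\ge 0: |a|\le r\}$. "Uniformly dense" means dense in the norm topology; closures in $D\times D$ are taken in the product of the norm topologies. A Dedekind algebra is a $\mathbf{ba\ell}$-algebra in which each nonempty subset bounded above has a supremum. A Dedekind completion of a $\mathbf{ba\ell}$-algebra $A$ is a Dedekind algebra $D(A)$ together with an injective $\mathbf{ba\ell}$-morphism $A\to D(A)$ whose image is join-dense in $D(A)$ (every element of $D(A)$ is a join of elements of the image); it exists and is unique up to isomorphism, and $A$ is identified with its image in $D(A)$. A binary relation $\lhd$ on a $\mathbf{ba\ell}$-algebra $A$ is a proximity if: (P1) $0\lhd0$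 and $1\lhd1$; (P2) $a\lhd b$ implies $a\le b$; (P3) $a\le b\lhd c\le d$ implies $a\lhd d$; (P4) $a\lhd b,c$ implies $a\lhd b\wedge c$; (P5) $a\lhd b$ implies $-b\lhd-a$; (P6) $a\lhd b$ and $c\lhd d$ imply $a+c\lhd b+d$; (P7) $a\lhd b$ and $0<r\in\mathbb R$ imply $ra\lhd rb$; (P8) $a,b,c,d\ge0$ with $a\lhd b$ and $c\lhd d$ imply $ac\lhd bd$; (P9) $a\lhd b$ implies there is $c\in A$ with $a\lhd c\lhd b$; (P10) $a>0$ implies there is $0<b\in A$ with $b\lhd a$. The pair $(A,\lhd)$ is then called a proximity $\mathbf{ba\ell}$-algebra. A KT-proximity on a Dedekind algebra $D$ is a proximity $\lhd$ on $D$ satisfying in addition: (KT) $a\lhd b$ implies there is $c\in D$ with $c\lhd c$ and $a\lhd c\lhd b$. A KT-algebra is a pair $(D,\lhd)$ where $D$ is a Dedekind algebra and $\lhd$ is a KT-proximity on $D$ that is a closed subset of $D\times D$. *)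

theory Defs
  imports "HOL-Analysis.Analysis" "HOL-Library.Lattice_Algebras" "HOL-Library.Lub_Glb"
begin

text \<open>
  Commutative unital \<open>\<ell>\<close>-algebras over the reals.  The class is built without \<^class>\<open>zero_neq_one\<close>
  (hence not on \<^class>\<open>real_algebra_1\<close>), so that the zero algebra is not excluded.
  Compatibility of the order with addition is part of \<^class>\<open>lattice_ab_group_add\<close>.
\<close>

class ell_algebra = real_algebra + comm_ring + comm_monoid_mult + lattice_ab_group_add +
  assumes ell_mult_nonneg: "0 \<le> a \<Longrightarrow> 0 \<le> b \<Longrightarrow> 0 \<le> a * b"
    and ell_scaleR_nonneg: "0 \<le> a \<Longrightarrow> 0 \<le> r \<Longrightarrow> 0 \<le> r *\<^sub>R a"

class bal_algebra = ell_algebra +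
  assumes bal_bounded: "\<exists>n::nat. 1 \<le> n \<and> a \<le> real n *\<^sub>R 1"
    and bal_archimedean: "(\<And>n::nat. 1 \<le> n \<Longrightarrow> real n *\<^sub>R a \<le> b) \<Longrightarrow> a \<le> 0"

class dedekind_algebra = bal_algebra +
  assumes dedekind_complete: "X \<noteq> {} \<Longrightarrow> (\<exists>u. \<forall>x\<in>X. x \<le> u) \<Longrightarrow>
    \<exists>s. (\<forall>x\<in>X. x \<le> s) \<and> (\<forall>u. (\<forall>x\<in>X. x \<le> u) \<longrightarrow> s \<le> u)"

definition bal_morphism :: "('a::bal_algebra \<Rightarrow> 'b::bal_algebra) \<Rightarrow> bool" where
  "bal_morphism f \<longleftrightarrow> linear f \<and> f 1 = 1 \<and> (\<forall>a b. f (a * b) = f a * f b) \<and>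
     (\<forall>a b. f (sup a b) = sup (f a) (f b)) \<and> (\<forall>a b. f (inf a b) = inf (f a) (f b))"

definition dedekind_completion :: "('a::bal_algebra \<Rightarrow> 'd::dedekind_algebra) \<Rightarrow> bool" where
  "dedekind_completion e \<longleftrightarrow>
     bal_morphism e \<and> inj e \<and> (\<forall>d. \<exists>X \<subseteq> range e. isLub UNIV X d)"

definition bal_norm :: "'a::bal_algebra \<Rightarrow> real" where
  "bal_norm a = Inf {r. 0 \<le> r \<and> sup a (- a) \<le> r *\<^sub>R 1}"

definition bal_dist :: "'a::bal_algebra \<Rightarrow> 'a \<Rightarrow> real" where
  "bal_dist a b = bal_norm (a - b)"

definition norm_topology :: "'a::bal_algebra topology" where
  "norm_topology = Metric_space.mtopology UNIV bal_dist"

definition uniformly_dense :: "'a::bal_algebra set \<Rightarrow> bool" where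
  "uniformly_dense X \<longleftrightarrow> norm_topology closure_of X = UNIV"

locale proximity =
  fixes prox :: "'a::bal_algebra \<Rightarrow> 'a \<Rightarrow> bool" (infix \<open>\<lhd>\<close> 50)
  assumes P1: "0 \<lhd> 0" "1 \<lhd> 1"
    and P2: "a \<lhd> b \<Longrightarrow> a \<le> b"
    and P3: "a \<le> b \<Longrightarrow> b \<lhd> c \<Longrightarrow> c \<le> d \<Longrightarrow> a \<lhd> d"
    and P4: "a \<lhd> b \<Longrightarrow> a \<lhd> c \<Longrightarrow> a \<lhd> inf b c"
    and P5: "a \<lhd> b \<Longrightarrow> - b \<lhd> - a"
    and P6: "a \<lhd> b \<Longrightarrow> c \<lhd> d \<Longrightarrow> a + c \<lhd> b + d"
    and P7: "a \<lhd> b \<Longrightarrow> 0 < r \<Longrightarrow> r *\<^sub>R a \<lhd> r *\<^sub>R b"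
    and P8: "0 \<le> a \<Longrightarrow> 0 \<le> b \<Longrightarrow> 0 \<le> c \<Longrightarrow> 0 \<le> d \<Longrightarrow> a \<lhd> b \<Longrightarrow> c \<lhd> d \<Longrightarrow> a * c \<lhd> b * d"
    and P9: "a \<lhd> b \<Longrightarrow> \<exists>c. a \<lhd> c \<and> c \<lhd> b"
    and P10: "0 < a \<Longrightarrow> \<exists>b. 0 < b \<and> b \<lhd> a"

locale KT_proximity = proximity prox
  for prox :: "'d::dedekind_algebra \<Rightarrow> 'd \<Rightarrow> bool" (infix \<open>\<lhd>\<close> 50) +
  assumes KT: "a \<lhd> b \<Longrightarrow> \<exists>c. c \<lhd> c \<and> a \<lhd> c \<and> c \<lhd> b"

definition KT_algebra :: "('d::dedekind_algebra \<Rightarrow> 'd \<Rightarrow> bool) \<Rightarrow> bool" where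
  "KT_algebra prox \<longleftrightarrow> KT_proximity prox \<and>
     closedin (prod_topology norm_topology norm_topology) {(a, b). prox a b}"

text \<open>
  The relation on \<open>D\<close> obtained by transporting a relation on \<open>S\<close> along \<open>e : S \<rightarrow> D\<close>
  and taking the closure in \<open>D \<times> D\<close>.
\<close>

definition closure_prox ::
  "('a::bal_algebra \<Rightarrow> 'd::dedekind_algebra) \<Rightarrow> ('a \<Rightarrow> 'a \<Rightarrow> bool) \<Rightarrow> 'd \<Rightarrow> 'd \<Rightarrow> bool" where
  "closure_prox e prox x y \<longleftrightarrow>
     (x, y) \<in> prod_topology norm_topology norm_topology closure_of {(e a, e b) |a b. prox a b}"

text \<open>
  \<^const>\<open>Metric_space.mtopology\<close> is meaningful only for an actual metric; the following shows that
  \<^const>\<open>bal_dist\<close> is one.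
\<close>

lemma bal_one_nonneg: "0 \<le> (1::'a::bal_algebra)"
proof -
  obtain n :: nat where n: "1 \<le> n" "sup 0 1 \<le> real n *\<^sub>R (1::'a)"
    using bal_bounded by blast
  have "0 \<le> real n *\<^sub>R (1::'a)"
    using n(2) sup.cobounded1 order.trans by blast
  then have "0 \<le> inverse (real n) *\<^sub>R (real n *\<^sub>R (1::'a))"
    by (rule ell_scaleR_nonneg) simp
  with n(1) show ?thesis by simp
qed

lemma bal_scaleR_one_mono: "r \<le> s \<Longrightarrow> r *\<^sub>R (1::'a::bal_algebra) \<le> s *\<^sub>R 1"
  using ell_scaleR_nonneg[OF bal_one_nonneg, of "s - r"] by (simp add: scaleR_left_diff_distrib)

lemma bal_norm_set_ne: "{r. 0 \<le> r \<and> sup a (- a) \<le> r *\<^sub>R (1::'a::bal_algebra)} \<noteq> {}"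
proof -
  obtain n :: nat where "sup a (- a) \<le> real n *\<^sub>R 1"
    using bal_bounded by blast
  then show ?thesis by (auto intro!: exI[of _ "real n"])
qed

lemma bal_norm_nonneg: "0 \<le> bal_norm a"
  unfolding bal_norm_def by (rule cInf_greatest[OF bal_norm_set_ne]) simp

lemma bal_norm_le: "0 \<le> r \<Longrightarrow> sup a (- a) \<le> r *\<^sub>R 1 \<Longrightarrow> bal_norm a \<le> r"
  unfolding bal_norm_def by (rule cInf_lower) (auto intro: bdd_belowI)

lemma bal_norm_less:
  assumes "bal_norm a < s" shows "sup a (- a) \<le> s *\<^sub>R 1"
proof -
  obtain r where "sup a (- a) \<le> r *\<^sub>R 1" "r < s"
    using cInf_lessD[OF bal_norm_set_ne, of a s] assms unfolding bal_norm_def by auto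
  then show ?thesis using bal_scaleR_one_mono[of r s] by (meson less_imp_le order.trans)
qed

lemma bal_norm_minus: "bal_norm (- a) = bal_norm a"
  unfolding bal_norm_def by (simp add: sup.commute)

lemma bal_norm_triangle: "bal_norm (a + b) \<le> bal_norm a + bal_norm b"
proof (rule field_le_epsilon)
  fix \<epsilon> :: real assume "0 < \<epsilon>"
  define r s where "r = bal_norm a + \<epsilon> / 2" and "s = bal_norm b + \<epsilon> / 2"
  have "sup a (- a) \<le> r *\<^sub>R 1" "sup b (- b) \<le> s *\<^sub>R 1"
    by (rule bal_norm_less, use \<open>0 < \<epsilon>\<close> in \<open>simp add: r_def s_def\<close>)+
  then have "a + b \<le> r *\<^sub>R 1 + s *\<^sub>R 1" "(- a) + (- b) \<le> r *\<^sub>R 1 + s *\<^sub>R 1"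
    by (meson add_mono le_sup_iff)+
  then have "sup (a + b) (- (a + b)) \<le> (r + s) *\<^sub>R 1"
    by (simp add: scaleR_left_distrib add.commute)
  moreover have "0 \<le> r + s"
    using \<open>0 < \<epsilon>\<close> bal_norm_nonneg[of a] bal_norm_nonneg[of b] by (simp add: r_def s_def)
  ultimately have "bal_norm (a + b) \<le> r + s" by (intro bal_norm_le)
  then show "bal_norm (a + b) \<le> bal_norm a + bal_norm b + \<epsilon>" by (simp add: r_def s_def)
qed

lemma bal_norm_eq_0_imp_nonpos:
  assumes "bal_norm a = 0" shows "a \<le> 0"
proof (rule bal_archimedean[where b = 1])
  fix n :: nat assume n: "1 \<le> n"
  have "sup a (- a) \<le> inverse (real n) *\<^sub>R 1"
    using assms n by (intro bal_norm_less) simp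
  then have "0 \<le> inverse (real n) *\<^sub>R 1 - a" by simp
  then have "0 \<le> real n *\<^sub>R (inverse (real n) *\<^sub>R 1 - a)"
    by (rule ell_scaleR_nonneg) simp
  with n show "real n *\<^sub>R a \<le> 1" by (simp add: scaleR_right_diff_distrib)
qed

lemma bal_norm_eq_0_iff: "bal_norm a = 0 \<longleftrightarrow> a = 0"
proof
  assume "bal_norm a = 0"
  then have "a \<le> 0" "- a \<le> 0"
    by (auto intro!: bal_norm_eq_0_imp_nonpos simp: bal_norm_minus simp del: neg_le_0_iff_le)
  then show "a = 0" by simp
next
  assume "a = 0"
  then show "bal_norm a = 0"
    using bal_norm_le[of 0 a] bal_norm_nonneg[of a] by simp
qed

interpretation bal_metric: Metric_space "UNIV :: 'a::bal_algebra set" bal_dist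
proof
  fix x y z :: 'a
  show "0 \<le> bal_dist x y" by (simp add: bal_dist_def bal_norm_nonneg)
  show "bal_dist x y = bal_dist y x"
    unfolding bal_dist_def using bal_norm_minus[of "x - y"] by simp
  show "bal_dist x y = 0 \<longleftrightarrow> x = y" by (simp add: bal_dist_def bal_norm_eq_0_iff)
  show "bal_dist x z \<le> bal_dist x y + bal_dist y z"
    unfolding bal_dist_def using bal_norm_triangle[of "x - y" "y - z"] by simp
qed

end

theory Submission
  imports Defs
begin

text \<open>
  By density and (P3), \<open>x \<lhd>' y\<close> holds iff for every \<open>\<epsilon> > 0\<close> there are \<open>a \<lhd> b\<close> in \<open>S\<close> with
  \<open>x \<le> a\<close> and \<open>b \<le> y + \<epsilon>\<close>; all axioms but (P9) and (KT) follow directly.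
  For (KT), interpolate \<open>a = a\<^sub>0 \<lhd> a\<^sub>1 \<lhd> \<dots> \<lhd> b\<close> in \<open>S\<close>.  If \<open>b \<le> a + N\<epsilon>\<close>, then the join
  \<open>c\<close> of the elements \<open>a\<^sub>i - i\<epsilon>\<close>, \<open>i \<le> N\<close>, satisfies \<open>a \<le> c \<le> b\<close> and \<open>c \<lhd> c + \<epsilon>\<close>.
  Given \<open>x \<lhd>' y\<close>, repeated refinement yields a Cauchy sequence with
  \<open>x \<le> c\<^sub>n \<le> y + 2\<^sup>-\<^sup>n\<close> and \<open>c\<^sub>n \<lhd>' c\<^sub>n + 2\<^sup>-\<^sup>n\<close>;
  the next term is interpolated between \<open>x \<or> (c\<^sub>n - 2\<epsilon>)\<close> and \<open>y \<and> (c\<^sub>n + \<epsilon>)\<close>, \<open>\<epsilon> = 2\<^sup>-\<^sup>n\<close>,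
  which are \<open>\<lhd>'\<close>-related because \<open>c\<^sub>n - 2\<epsilon> \<lhd>' c\<^sub>n - \<epsilon> \<le> y\<close>.  The limit is
  reflexive and lies between \<open>x\<close> and \<open>y\<close>.
\<close>

section \<open>Order and norm\<close>

text \<open>This instance and the next give access to the monotonicity rules
  \<open>mult_mono\<close> and \<open>scaleR_left_mono\<close>.\<close>

instance ell_algebra \<subseteq> ordered_comm_ring
proof
  fix a b c :: 'a
  assume "a \<le> b" "0 \<le> c"
  then show "c * a \<le> c * b"
    using ell_mult_nonneg[of c "b - a"] by (simp add: right_diff_distrib)
qed

instance bal_algebra \<subseteq> ordered_real_vector
proof
  fix x y :: 'a and a b :: real
  show "a *\<^sub>R x \<le> a *\<^sub>R y" if "x \<le> y" "0 \<le> a"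
    using that ell_scaleR_nonneg[of "y - x" a] by (simp add: scaleR_right_diff_distrib)
  show "a *\<^sub>R x \<le> b *\<^sub>R x" if "a \<le> b" "0 \<le> x"
    using that ell_scaleR_nonneg[of x "b - a"] by (simp add: scaleR_left_diff_distrib)
qed

text \<open>Keeps account of scalar errors along a chain of inequalities: the last premise reduces
  each later estimate to arithmetic of real numbers.\<close>

lemma bal_le_add_trans:
  fixes a b c :: "'a::bal_algebra"
  assumes "a \<le> b + r *\<^sub>R 1" "b \<le> c + s *\<^sub>R 1" "r + s \<le> t"
  shows "a \<le> c + t *\<^sub>R 1"
proof -
  have "a \<le> (c + s *\<^sub>R 1) + r *\<^sub>R 1"
    using assms(1,2) by (meson add_right_mono order.trans)
  also have "\<dots> = c + (r + s) *\<^sub>R 1" by (simp add: scaleR_left_distrib ac_simps)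
  also have "\<dots> \<le> c + t *\<^sub>R 1" by (intro add_left_mono bal_scaleR_one_mono assms(3))
  finally show ?thesis .
qed

text \<open>The archimedean axiom applies to \<open>a - b\<close> with bound 1, because the
  hypothesis at \<open>inverse (real n)\<close> says that n times \<open>a - b\<close> is at most
  1.\<close>

lemma bal_le_epsilon:
  fixes a b :: "'a::bal_algebra"
  assumes "\<And>\<epsilon>. 0 < \<epsilon> \<Longrightarrow> a \<le> b + \<epsilon> *\<^sub>R 1"
  shows "a \<le> b"
proof -
  have "a - b \<le> 0"
  proof (rule bal_archimedean[where b = 1])
    fix n :: nat assume n: "1 \<le> n"
    have "a - b \<le> inverse (real n) *\<^sub>R 1"
      using assms[of "inverse (real n)"] n by (simp add: diff_le_eq add.commute)
    then have "real n *\<^sub>R (a - b) \<le> real n *\<^sub>R (inverse (real n) *\<^sub>R 1)"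
      by (intro scaleR_left_mono) auto
    with n show "real n *\<^sub>R (a - b) \<le> 1" by simp
  qed
  then show ?thesis by simp
qed

lemma bal_dist_less_imp:
  assumes "bal_dist a b < r"
  shows "a \<le> b + r *\<^sub>R 1" "b \<le> a + r *\<^sub>R 1"
  using bal_norm_less[of "a - b" r] assms
  by (auto simp: bal_dist_def diff_le_eq add.commute)

lemma bal_dist_less:
  assumes "a \<le> b + r *\<^sub>R 1" "b \<le> a + r *\<^sub>R 1" "0 \<le> r" "r < s"
  shows "bal_dist a b < s"
proof -
  have "bal_norm (a - b) \<le> r"
    using assms by (intro bal_norm_le) (auto simp: diff_le_eq add.commute)
  with assms(4) show ?thesis by (simp add: bal_dist_def)
qed

lemma uniformly_dense_iff:
  "uniformly_dense X \<longleftrightarrow> (\<forall>x. \<forall>\<epsilon>>0. \<exists>y\<in>X. bal_dist x y < \<epsilon>)"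
  unfolding uniformly_dense_def norm_topology_def
  by (auto simp: bal_metric.metric_closure_of)

lemma in_closure_of_prod_norm_topology:
  "(x, y) \<in> prod_topology norm_topology norm_topology closure_of X \<longleftrightarrow>
     (\<forall>\<epsilon>>0. \<exists>(a, b)\<in>X. bal_dist x a < \<epsilon> \<and> bal_dist y b < \<epsilon>)" (is "?L \<longleftrightarrow> ?R")
proof
  assume L: ?L
  show ?R
  proof (intro allI impI)
    fix \<epsilon> :: real assume "0 < \<epsilon>"
    have "openin (prod_topology norm_topology norm_topology)
        (bal_metric.mball x \<epsilon> \<times> bal_metric.mball y \<epsilon>)"
      by (simp add: norm_topology_def openin_prod_Times_iff)
    with L \<open>0 < \<epsilon>\<close> have "\<exists>p\<in>X. p \<in> bal_metric.mball x \<epsilon> \<times> bal_metric.mball y \<epsilon>"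
      unfolding in_closure_of by (metis SigmaI bal_metric.centre_in_mball_iff UNIV_I)
    then show "\<exists>(a, b)\<in>X. bal_dist x a < \<epsilon> \<and> bal_dist y b < \<epsilon>" by fastforce
  qed
next
  assume R: ?R
  show ?L
    unfolding in_closure_of
  proof (intro conjI allI impI)
    show "(x, y) \<in> topspace (prod_topology norm_topology norm_topology)"
      by (simp add: norm_topology_def)
    fix T assume "(x, y) \<in> T \<and> openin (prod_topology norm_topology norm_topology) T"
    then obtain U V where "openin norm_topology U" "openin norm_topology V"
      and UV: "x \<in> U" "y \<in> V" "U \<times> V \<subseteq> T"
      unfolding openin_prod_topology_alt by meson
    then obtain r s where "0 < r" "bal_metric.mball x r \<subseteq> U" "0 < s" "bal_metric.mball y s \<subseteq> V"
      unfolding norm_topology_def bal_metric.openin_mtopology by meson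
    moreover from R \<open>0 < r\<close> \<open>0 < s\<close>
    obtain a b where "(a, b) \<in> X" "bal_dist x a < min r s" "bal_dist y b < min r s"
      by (metis (mono_tags, lifting) case_prodE min_less_iff_conj)
    ultimately have "a \<in> U" "b \<in> V" by auto
    with UV \<open>(a, b) \<in> X\<close> show "\<exists>p. p \<in> X \<and> p \<in> T" by blast
  qed
qed

text \<open>Norm limits come from order completeness: the limit is the supremum of the lower
  estimates \<open>c n - r n *\<^sub>R 1\<close>, which are bounded above by every upper estimate
  \<open>c m + r m *\<^sub>R 1\<close>.\<close>

lemma dedekind_Cauchy_limit:
  fixes c :: "nat \<Rightarrow> 'd::dedekind_algebra"
  assumes upper: "\<And>m n. n \<le> m \<Longrightarrow> c m \<le> c n + r n *\<^sub>R 1"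
    and lower: "\<And>m n. n \<le> m \<Longrightarrow> c n \<le> c m + r n *\<^sub>R 1"
  obtains l where "\<And>n. l \<le> c n + r n *\<^sub>R 1" "\<And>n. c n \<le> l + r n *\<^sub>R 1"
proof -
  \<comment> \<open>Both sides are compared with the term of index \<open>max m n\<close>.\<close>
  have bound: "c n - r n *\<^sub>R 1 \<le> c m + r m *\<^sub>R 1" for m n
    using lower[of n "max m n"] upper[of m "max m n"]
    by (simp add: diff_le_eq) (meson add_right_mono order.trans)
  have "range (\<lambda>n. c n - r n *\<^sub>R 1) \<noteq> {}"
    "\<exists>u. \<forall>x\<in>range (\<lambda>n. c n - r n *\<^sub>R 1). x \<le> u"
    using bound by auto
  from dedekind_complete[OF this] obtain l where
    "\<And>n. c n - r n *\<^sub>R 1 \<le> l" "\<And>u. (\<And>n. c n - r n *\<^sub>R 1 \<le> u) \<Longrightarrow> l \<le> u"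
    by auto
  with bound show thesis by (intro that[of l]) (auto simp: diff_le_eq)
qed

section \<open>Almost reflexive elements\<close>

context proximity
begin

lemma prox_scalar: "r *\<^sub>R 1 \<lhd> r *\<^sub>R 1"
proof (cases r "0::real" rule: linorder_cases)
  case less
  then show ?thesis using P5[OF P7[OF P1(2), of "- r"]] by simp
qed (use P1 P7 in auto)

lemma prox_add_scalar: "a \<lhd> b \<Longrightarrow> a + r *\<^sub>R 1 \<lhd> b + r *\<^sub>R 1"
  by (rule P6[OF _ prox_scalar])

lemma prox_sup: "a \<lhd> c \<Longrightarrow> b \<lhd> c \<Longrightarrow> sup a b \<lhd> c"
  using P5[OF P4[OF P5 P5, of a c b]] by (simp add: neg_inf_eq_sup)

lemma prox_Sup_fin:
  assumes "finite A" "A \<noteq> {}" "\<And>a. a \<in> A \<Longrightarrow> a \<lhd> c"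
  shows "Sup_fin A \<lhd> c"
  using assms by (induction rule: finite_ne_induct) (auto intro: prox_sup)

text \<open>The lowered chain closes into a cycle: each \<open>g i\<close> with i < N is proximal to
  \<open>g (Suc i)\<close> raised by \<epsilon>, and the last term lies below the first. So every
  joinand is proximal to c + \<epsilon>, and hence so is the join.\<close>

lemma ex_almost_reflexive_between:
  assumes "a \<lhd> b" "0 < \<epsilon>"
  obtains c where "a \<le> c" "c \<le> b" "c \<lhd> c + \<epsilon> *\<^sub>R 1"
proof -
  \<comment> \<open>The invariant \<open>f i \<lhd> b\<close> is what permits the next use of
    (P9).\<close>
  have "\<exists>f. \<forall>i. (f i \<lhd> b \<and> (i = 0 \<longrightarrow> f i = a)) \<and> f i \<lhd> f (Suc i)"
    by (rule dependent_nat_choice[where P = "\<lambda>i x. x \<lhd> b \<and> (i = 0 \<longrightarrow> x = a)"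
          and Q = "\<lambda>i x y. x \<lhd> y"]) (use assms(1) P9 in auto)
  then obtain f where f: "f 0 = a" "\<And>i::nat. f i \<lhd> b" "\<And>i. f i \<lhd> f (Suc i)"
    by metis
  obtain M :: nat where M: "b - a \<le> real M *\<^sub>R 1"
    using bal_bounded by blast
  obtain N' :: nat where "real M < real N' * \<epsilon>"
    using reals_Archimedean3[OF assms(2)] by blast
  \<comment> \<open>The successor makes N positive, so that \<open>g_prox\<close> covers index 0,
    where the cycle closes.\<close>
  define N where "N = Suc N'"
  have "real M \<le> real N * \<epsilon>"
    using \<open>real M < real N' * \<epsilon>\<close> assms(2) by (simp add: N_def algebra_simps)
  from M bal_scaleR_one_mono[OF this] have "b - a \<le> (real N * \<epsilon>) *\<^sub>R 1"
    by (rule order.trans)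
  then have N: "b \<le> a + (real N * \<epsilon>) *\<^sub>R 1"
    by (simp only: diff_le_eq add.commute)
  define g where "g i = f i - (real i * \<epsilon>) *\<^sub>R 1" for i
  define c where "c = Sup_fin (g ` {..N})"
  have g_le: "g i \<le> c" if "i \<le> N" for i
    unfolding c_def using that by (intro Sup_fin.coboundedI) auto
  have g_prox: "g i \<lhd> c + \<epsilon> *\<^sub>R 1" if "i < N" for i
  proof -
    have "g i \<lhd> f (Suc i) - (real i * \<epsilon>) *\<^sub>R 1"
      using prox_add_scalar[OF f(3), of i "- (real i * \<epsilon>)"] by (simp add: g_def)
    moreover have "f (Suc i) - (real i * \<epsilon>) *\<^sub>R 1 = g (Suc i) + \<epsilon> *\<^sub>R 1"
      by (simp add: g_def algebra_simps)
    moreover have "g (Suc i) + \<epsilon> *\<^sub>R 1 \<le> c + \<epsilon> *\<^sub>R 1"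
      using g_le[of "Suc i"] that by simp
    ultimately show ?thesis using P3[OF order.refl] by metis
  qed
  have "g N \<le> g 0"
  proof -
    have "f N \<le> a + (real N * \<epsilon>) *\<^sub>R 1"
      using P2[OF f(2)] N by (rule order.trans)
    then show ?thesis by (simp add: g_def f(1) diff_le_eq)
  qed
  then have "g N \<lhd> c + \<epsilon> *\<^sub>R 1"
    using P3 g_prox[of 0] by (auto simp: N_def)
  with g_prox have "g i \<lhd> c + \<epsilon> *\<^sub>R 1" if "i \<le> N" for i
    using that by (cases "i = N") auto
  then have "c \<lhd> c + \<epsilon> *\<^sub>R 1"
    unfolding c_def by (intro prox_Sup_fin) auto
  moreover have "a \<le> c" using g_le[of 0] by (simp add: g_def f(1))
  moreover have "c \<le> b"
    unfolding c_def
  proof (rule Sup_fin.boundedI)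
    fix x assume "x \<in> g ` {..N}"
    then obtain i where "x = g i" by blast
    moreover have "0 \<le> (real i * \<epsilon>) *\<^sub>R (1::'a)"
      using assms(2) by (intro ell_scaleR_nonneg bal_one_nonneg) auto
    then have "g i \<le> f i" by (simp add: g_def diff_le_eq)
    ultimately show "x \<le> b" using P2[OF f(2)] order.trans by blast
  qed auto
  ultimately show thesis using that by blast
qed

end

section \<open>The closure of a proximity\<close>

locale dense_proximity = proximity prox
  for prox :: "'s::bal_algebra \<Rightarrow> 's \<Rightarrow> bool" (infix \<open>\<lhd>\<close> 50) +
  fixes e :: "'s \<Rightarrow> 'd::dedekind_algebra"
  assumes morphism: "bal_morphism e"
    and inj: "inj e"
    and dense: "uniformly_dense (range e)"
begin

section \<open>Density and the closure expressed by the order\<close>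

abbreviation prox_closure :: "'d \<Rightarrow> 'd \<Rightarrow> bool" (infix \<open>\<lhd>''\<close> 50)
  where "x \<lhd>' y \<equiv> closure_prox e prox x y"

lemma e_simps [simp]:
  "e (a + b) = e a + e b" "e (a - b) = e a - e b" "e (- a) = - e a" "e (r *\<^sub>R a) = r *\<^sub>R e a"
  "e 0 = 0" "e 1 = 1" "e (a * b) = e a * e b" "e (sup a b) = sup (e a) (e b)"
  "e (inf a b) = inf (e a) (e b)"
  using morphism
  by (auto simp: bal_morphism_def linear_add linear_diff linear_neg linear_scale linear_0)

text \<open>The order is definable from joins, so an injective map that preserves joins also
  reflects it.\<close>

lemma e_le_iff [simp]: "e a \<le> e b \<longleftrightarrow> a \<le> b"
  by (metis e_simps(8) inj injD le_iff_sup)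

text \<open>Density in one-sided form: approximate the midpoint of the interval to within half its
  length.\<close>

lemma ex_e_between:
  assumes "r < s"
  obtains a where "x + r *\<^sub>R 1 \<le> e a" "e a \<le> x + s *\<^sub>R 1"
proof -
  define m where "m = (r + s) / 2"
  obtain a where "bal_dist (x + m *\<^sub>R 1) (e a) < (s - r) / 2"
    using dense assms unfolding uniformly_dense_iff by (metis diff_gt_0_iff_gt half_gt_zero image_iff)
  from bal_dist_less_imp[OF this]
  have "x + m *\<^sub>R 1 \<le> e a + ((s - r) / 2) *\<^sub>R 1" "e a \<le> x + m *\<^sub>R 1 + ((s - r) / 2) *\<^sub>R 1" .
  moreover have "m = r + (s - r) / 2" "s = m + (s - r) / 2" by (simp_all add: m_def field_simps)
  then have "x + m *\<^sub>R 1 = x + r *\<^sub>R 1 + ((s - r) / 2) *\<^sub>R 1"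
    "x + s *\<^sub>R 1 = x + m *\<^sub>R 1 + ((s - r) / 2) *\<^sub>R 1"
    by (metis add.assoc scaleR_left_distrib)+
  ultimately show thesis using that[of a] by (simp only: add_le_cancel_right)
qed

text \<open>Replaces the topology by inequalities. Two-sided approximations become one-sided by
  shifting both elements up by a scalar, which preserves the proximity. Conversely, (P3) lets the
  pair \<open>a\<close>, \<open>b\<close> be replaced by elements of S close to \<open>x\<close>
  from below and to \<open>y\<close> from above.\<close>

lemma prox_closure_iff:
  "x \<lhd>' y \<longleftrightarrow> (\<forall>\<epsilon>>0. \<exists>a b. a \<lhd> b \<and> x \<le> e a \<and> e b \<le> y + \<epsilon> *\<^sub>R 1)" (is "?L \<longleftrightarrow> ?R")
proof
  assume L: ?L
  show ?R
  proof (intro allI impI)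
    fix \<epsilon> :: real assume "0 < \<epsilon>"
    then obtain a b where "a \<lhd> b" and d: "bal_dist x (e a) < \<epsilon> / 2" "bal_dist y (e b) < \<epsilon> / 2"
      using L unfolding closure_prox_def in_closure_of_prod_norm_topology
      by (fastforce dest: spec[of _ "\<epsilon> / 2"])
    have "e b + (\<epsilon> / 2) *\<^sub>R 1 \<le> y + \<epsilon> *\<^sub>R 1"
      by (rule bal_le_add_trans[OF order.refl bal_dist_less_imp(2)[OF d(2)]]) simp
    moreover have "x \<le> e a + (\<epsilon> / 2) *\<^sub>R 1" by (rule bal_dist_less_imp(1)[OF d(1)])
    moreover note prox_add_scalar[OF \<open>a \<lhd> b\<close>, of "\<epsilon> / 2"]
    ultimately show "\<exists>a b. a \<lhd> b \<and> x \<le> e a \<and> e b \<le> y + \<epsilon> *\<^sub>R 1"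
      by (intro exI[of _ "a + (\<epsilon> / 2) *\<^sub>R 1"] exI[of _ "b + (\<epsilon> / 2) *\<^sub>R 1"]) simp
  qed
next
  assume R: ?R
  show ?L
    unfolding closure_prox_def in_closure_of_prod_norm_topology
  proof (intro allI impI)
    fix \<epsilon> :: real assume "0 < \<epsilon>"
    define \<delta> where "\<delta> = \<epsilon> / 2"
    have \<delta>: "0 < \<delta>" "\<delta> < \<epsilon>" using \<open>0 < \<epsilon>\<close> by (auto simp: \<delta>_def)
    obtain a b where ab: "a \<lhd> b" "x \<le> e a" "e b \<le> y + (\<delta> / 2) *\<^sub>R 1"
      using R \<delta>(1) half_gt_zero by metis
    \<comment> \<open>The element \<open>t\<close> is sought above y + \<delta>/2, not merely above
      y, to leave room for \<open>e b\<close>.\<close>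
    obtain s where s: "x + (- \<delta>) *\<^sub>R 1 \<le> e s" "e s \<le> x + 0 *\<^sub>R 1"
      by (rule ex_e_between[of "- \<delta>" 0 x]) (use \<delta> in auto)
    obtain t where t: "y + (\<delta> / 2) *\<^sub>R 1 \<le> e t" "e t \<le> y + \<delta> *\<^sub>R 1"
      by (rule ex_e_between[of "\<delta> / 2" \<delta> y]) (use \<delta> in auto)
    have "0 \<le> \<delta> *\<^sub>R (1::'d)" "0 \<le> (\<delta> / 2) *\<^sub>R (1::'d)"
      using \<delta> by (intro ell_scaleR_nonneg bal_one_nonneg; simp)+
    then have incr: "z \<le> z + \<delta> *\<^sub>R 1" "z \<le> z + (\<delta> / 2) *\<^sub>R 1" for z :: 'd by simp_all
    have "e s \<le> e a" using s(2) ab(2) by (metis order.trans scaleR_zero_left add.right_neutral)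
    moreover have "e b \<le> e t" using ab(3) t(1) by (rule order.trans)
    ultimately have "s \<lhd> t" using ab(1) P3 by simp
    moreover have "bal_dist x (e s) < \<epsilon>"
    proof (rule bal_dist_less[OF _ _ _ \<delta>(2)])
      show "x \<le> e s + \<delta> *\<^sub>R 1" using s(1) by (simp add: diff_le_eq)
      show "e s \<le> x + \<delta> *\<^sub>R 1"
        using s(2) incr(1)[of x] by (metis add.right_neutral order.trans scaleR_zero_left)
    qed (use \<delta> in simp)
    moreover have "bal_dist y (e t) < \<epsilon>"
    proof (rule bal_dist_less[OF _ t(2) _ \<delta>(2)])
      show "y \<le> e t + \<delta> *\<^sub>R 1"
        using incr(2)[of y] t(1) incr(1)[of "e t"] by (meson order.trans)
    qed (use \<delta> in simp)
    ultimately show "\<exists>(a, b)\<in>{(e a, e b) |a b. a \<lhd> b}. bal_dist x a < \<epsilon> \<and> bal_dist y b < \<epsilon>"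
      by blast
  qed
qed

lemma prox_closureE:
  assumes "x \<lhd>' y" "0 < \<epsilon>"
  obtains a b where "a \<lhd> b" "x \<le> e a" "e b \<le> y + \<epsilon> *\<^sub>R 1"
  using assms unfolding prox_closure_iff by blast

section \<open>Proximity axioms other than interpolation\<close>

lemma prox_imp_prox_closure: "a \<lhd> b \<Longrightarrow> e a \<lhd>' e b"
  unfolding prox_closure_iff
  by (metis add.commute add_increasing bal_one_nonneg ell_scaleR_nonneg less_imp_le order.refl)

lemma prox_closure_le: "x \<lhd>' y \<Longrightarrow> x \<le> y"
  by (rule bal_le_epsilon) (meson P2 e_le_iff order.trans prox_closureE)

lemma prox_closure_mono: "x \<le> y \<Longrightarrow> y \<lhd>' z \<Longrightarrow> z \<le> w \<Longrightarrow> x \<lhd>' w"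
  unfolding prox_closure_iff by (meson add_right_mono order.trans)

text \<open>The form of closedness by which the limit in \<open>ex_reflexive_between\<close> is
  shown to be reflexive.\<close>

lemma prox_closure_epsilon:
  assumes "\<And>\<epsilon>. 0 < \<epsilon> \<Longrightarrow> x \<lhd>' y + \<epsilon> *\<^sub>R 1"
  shows "x \<lhd>' y"
  unfolding prox_closure_iff
proof (intro allI impI)
  fix \<epsilon> :: real assume "0 < \<epsilon>"
  then obtain a b where ab: "a \<lhd> b" "x \<le> e a" "e b \<le> y + (\<epsilon> / 2) *\<^sub>R 1 + (\<epsilon> / 2) *\<^sub>R 1"
    using assms[of "\<epsilon> / 2"] by (meson half_gt_zero prox_closureE)
  have "e b \<le> y + \<epsilon> *\<^sub>R 1" by (rule bal_le_add_trans[OF ab(3) order.refl]) simp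
  with ab show "\<exists>a b. a \<lhd> b \<and> x \<le> e a \<and> e b \<le> y + \<epsilon> *\<^sub>R 1" by blast
qed

lemma prox_closure_inf:
  assumes "x \<lhd>' y" "x \<lhd>' z"
  shows "x \<lhd>' inf y z"
  unfolding prox_closure_iff
proof (intro allI impI)
  fix \<epsilon> :: real assume "0 < \<epsilon>"
  obtain a b where ab: "a \<lhd> b" "x \<le> e a" "e b \<le> y + \<epsilon> *\<^sub>R 1"
    using assms(1) \<open>0 < \<epsilon>\<close> by (rule prox_closureE)
  obtain c d where cd: "c \<lhd> d" "x \<le> e c" "e d \<le> z + \<epsilon> *\<^sub>R 1"
    using assms(2) \<open>0 < \<epsilon>\<close> by (rule prox_closureE)
  have "inf a c \<lhd> inf b d"
    using ab(1) cd(1) by (meson P3 P4 inf_le1 inf_le2 order.refl)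
  moreover have "inf (e b) (e d) \<le> inf y z + \<epsilon> *\<^sub>R 1"
    unfolding add_inf_distrib_right using ab(3) cd(3) by (rule inf_mono)
  ultimately show "\<exists>a b. a \<lhd> b \<and> x \<le> e a \<and> e b \<le> inf y z + \<epsilon> *\<^sub>R 1"
    using ab(2) cd(2) by (intro exI[of _ "inf a c"] exI[of _ "inf b d"]) simp
qed

lemma prox_closure_minus:
  assumes "x \<lhd>' y"
  shows "- y \<lhd>' - x"
  unfolding prox_closure_iff
proof (intro allI impI)
  fix \<epsilon> :: real assume "0 < \<epsilon>"
  with assms obtain a b where ab: "a \<lhd> b" "x \<le> e a" "e b \<le> y + \<epsilon> *\<^sub>R 1"
    by (rule prox_closureE)
  \<comment> \<open>Negation moves the error to the left-hand side; adding \<epsilon> to both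
    elements returns it to the right.\<close>
  have "- b + \<epsilon> *\<^sub>R 1 \<lhd> - a + \<epsilon> *\<^sub>R 1" by (intro prox_add_scalar P5 ab(1))
  moreover have "- y \<le> - e b + \<epsilon> *\<^sub>R 1" using ab(3)
    by (metis add_right_mono diff_add_cancel minus_add uminus_add_conv_diff add.commute neg_le_iff_le)
  ultimately show "\<exists>a b. a \<lhd> b \<and> - y \<le> e a \<and> e b \<le> - x + \<epsilon> *\<^sub>R 1"
    using ab(2) by (intro exI[of _ "- b + \<epsilon> *\<^sub>R 1"] exI[of _ "- a + \<epsilon> *\<^sub>R 1"]) simp
qed

lemma prox_closure_sup:
  assumes "x \<lhd>' z" "y \<lhd>' z"
  shows "sup x y \<lhd>' z"
  using prox_closure_minus[OF prox_closure_inf[OF assms[THEN prox_closure_minus]]]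
  by (simp add: neg_inf_eq_sup)

lemma prox_closure_add:
  assumes "x \<lhd>' y" "z \<lhd>' w"
  shows "x + z \<lhd>' y + w"
  unfolding prox_closure_iff
proof (intro allI impI)
  fix \<epsilon> :: real assume "0 < \<epsilon>"
  then have "0 < \<epsilon> / 2" by simp
  obtain a b where ab: "a \<lhd> b" "x \<le> e a" "e b \<le> y + (\<epsilon> / 2) *\<^sub>R 1"
    using assms(1) \<open>0 < \<epsilon> / 2\<close> by (rule prox_closureE)
  obtain c d where cd: "c \<lhd> d" "z \<le> e c" "e d \<le> w + (\<epsilon> / 2) *\<^sub>R 1"
    using assms(2) \<open>0 < \<epsilon> / 2\<close> by (rule prox_closureE)
  have "e (b + d) \<le> (y + w + (\<epsilon> / 2) *\<^sub>R 1) + (\<epsilon> / 2) *\<^sub>R 1"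
    using add_mono[OF ab(3) cd(3)] by (simp add: ac_simps)
  then have "e (b + d) \<le> y + w + \<epsilon> *\<^sub>R 1"
    by (rule bal_le_add_trans[OF _ order.refl]) simp
  moreover have "x + z \<le> e (a + c)" using add_mono[OF ab(2) cd(2)] by simp
  ultimately show "\<exists>a b. a \<lhd> b \<and> x + z \<le> e a \<and> e b \<le> y + w + \<epsilon> *\<^sub>R 1"
    using P6[OF ab(1) cd(1)] by blast
qed

lemma prox_closure_scaleR:
  assumes "x \<lhd>' y" "0 < r"
  shows "r *\<^sub>R x \<lhd>' r *\<^sub>R y"
  unfolding prox_closure_iff
proof (intro allI impI)
  fix \<epsilon> :: real assume "0 < \<epsilon>"
  then have "0 < \<epsilon> / r" using assms(2) by simp
  with assms(1) obtain a b where ab: "a \<lhd> b" "x \<le> e a" "e b \<le> y + (\<epsilon> / r) *\<^sub>R 1"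
    by (rule prox_closureE)
  have "r *\<^sub>R e b \<le> r *\<^sub>R (y + (\<epsilon> / r) *\<^sub>R 1)"
    using ab(3) assms(2) by (intro scaleR_left_mono) auto
  also have "\<dots> = r *\<^sub>R y + \<epsilon> *\<^sub>R 1" using assms(2) by (simp add: scaleR_right_distrib)
  finally have "e (r *\<^sub>R b) \<le> r *\<^sub>R y + \<epsilon> *\<^sub>R 1" by simp
  moreover have "r *\<^sub>R x \<le> e (r *\<^sub>R a)"
    using ab(2) assms(2) by (simp add: scaleR_left_mono)
  ultimately show "\<exists>a b. a \<lhd> b \<and> r *\<^sub>R x \<le> e a \<and> e b \<le> r *\<^sub>R y + \<epsilon> *\<^sub>R 1"
    using P7[OF ab(1) assms(2)] by blast
qed

lemma prox_closure_mult:
  assumes "0 \<le> x" "0 \<le> z" "x \<lhd>' y" "z \<lhd>' w"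
  shows "x * z \<lhd>' y * w"
  unfolding prox_closure_iff
proof (intro allI impI)
  fix \<epsilon> :: real assume "0 < \<epsilon>"
  obtain n :: nat where n: "1 \<le> n" "y + w + 1 \<le> real n *\<^sub>R 1" using bal_bounded by blast
  \<comment> \<open>The product of y + \<delta> and w + \<delta> exceeds yw by \<delta>(y + w +
    \<delta>). The bound \<delta> \<le> 1 makes the bracket at most n, and \<delta>n \<le>
    \<epsilon> controls the whole excess.\<close>
  define \<delta> where "\<delta> = min 1 (\<epsilon> / real n)"
  have \<delta>: "0 < \<delta>" "\<delta> \<le> 1" "\<delta> * real n \<le> \<epsilon>"
    using \<open>0 < \<epsilon>\<close> n(1) by (auto simp: \<delta>_def min_def field_simps)
  obtain a b where ab: "a \<lhd> b" "x \<le> e a" "e b \<le> y + \<delta> *\<^sub>R 1"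
    using assms(3) \<delta>(1) by (rule prox_closureE)
  obtain c d where cd: "c \<lhd> d" "z \<le> e c" "e d \<le> w + \<delta> *\<^sub>R 1"
    using assms(4) \<delta>(1) by (rule prox_closureE)
  have pos: "0 \<le> a" "0 \<le> c"
    using assms(1,2) ab(2) cd(2) by (metis e_le_iff e_simps(5) order.trans)+
  then have pos': "0 \<le> b" "0 \<le> d"
    using P2[OF ab(1)] P2[OF cd(1)] by (auto intro: order.trans)
  have epos: "0 \<le> e a" "0 \<le> e b" "0 \<le> e d"
    using pos pos' by (metis e_le_iff e_simps(5))+
  have "x * z \<le> e a * e c" using ab(2) cd(2) epos(1) assms(2) by (rule mult_mono)
  moreover have "e b * e d \<le> y * w + \<epsilon> *\<^sub>R 1"
  proof -
    have "e b * e d \<le> (y + \<delta> *\<^sub>R 1) * (w + \<delta> *\<^sub>R 1)"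
      using ab(3) cd(3) epos by (intro mult_mono) (auto intro: order.trans)
    also have "\<dots> = y * w + \<delta> *\<^sub>R (y + w + \<delta> *\<^sub>R 1)"
      by (simp add: distrib_left distrib_right scaleR_right_distrib ac_simps)
    also have "\<dots> \<le> y * w + \<delta> *\<^sub>R (real n *\<^sub>R 1)"
    proof (intro add_left_mono scaleR_left_mono)
      have "y + w + \<delta> *\<^sub>R 1 \<le> y + w + 1 *\<^sub>R 1"
        by (intro add_left_mono bal_scaleR_one_mono \<delta>(2))
      then show "y + w + \<delta> *\<^sub>R 1 \<le> real n *\<^sub>R 1"
        using n(2) by (metis order.trans scaleR_one)
    qed (use \<delta> in simp)
    also have "\<dots> \<le> y * w + \<epsilon> *\<^sub>R 1"
      using bal_scaleR_one_mono[OF \<delta>(3)] by simp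
    finally show ?thesis .
  qed
  ultimately show "\<exists>a b. a \<lhd> b \<and> x * z \<le> e a \<and> e b \<le> y * w + \<epsilon> *\<^sub>R 1"
    using P8[OF pos(1) pos'(1) pos(2) pos'(2) ab(1) cd(1)]
    by (intro exI[of _ "a * c"] exI[of _ "b * d"]) simp
qed

text \<open>Since x is not below 0, some \<epsilon> > 0 has x not below \<epsilon>. An element
  \<open>a\<close> of S between x - \<epsilon> and x then has a nonzero positive part, which is
  still below x, and (P10) in S applies to it.\<close>

lemma ex_prox_closure_below:
  assumes "0 < x"
  shows "\<exists>y. 0 < y \<and> y \<lhd>' x"
proof -
  obtain \<epsilon> where "0 < \<epsilon>" and \<epsilon>: "\<not> x \<le> 0 + \<epsilon> *\<^sub>R 1"
    using assms bal_le_epsilon[of x 0] by (metis order.strict_iff_not)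
  obtain a where a: "x + (- \<epsilon>) *\<^sub>R 1 \<le> e a" "e a \<le> x + 0 *\<^sub>R 1"
    by (rule ex_e_between[of "- \<epsilon>" 0 x]) (use \<open>0 < \<epsilon>\<close> in auto)
  have "sup a 0 \<noteq> 0"
  proof
    assume "sup a 0 = 0"
    then have "e a \<le> 0" by (metis e_le_iff e_simps(5) sup.cobounded1)
    with a(1) have "x + (- \<epsilon>) *\<^sub>R 1 \<le> 0" by (rule order.trans)
    with \<epsilon> show False by (simp add: diff_le_eq)
  qed
  then have "0 < sup a 0" by (simp add: order.not_eq_order_implies_strict)
  then obtain b where b: "0 < b" "b \<lhd> sup a 0" using P10 by blast
  have "e b \<lhd>' x"
    by (rule prox_closure_mono[OF order.refl prox_imp_prox_closure[OF b(2)]])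
      (use a(2) assms in auto)
  moreover have "0 < e b"
    using b(1) by (metis e_le_iff e_simps(5) order.strict_iff_not)
  ultimately show ?thesis by blast
qed

lemma prox_closure_scalar: "r *\<^sub>R 1 \<lhd>' r *\<^sub>R 1"
  using prox_imp_prox_closure[OF prox_scalar[of r]] by simp

lemma prox_closure_add_scalar: "x \<lhd>' y \<Longrightarrow> x + r *\<^sub>R 1 \<lhd>' y + r *\<^sub>R 1"
  by (rule prox_closure_add[OF _ prox_closure_scalar])

section \<open>Reflexive elements between related elements\<close>

lemma ex_almost_reflexive_closure:
  assumes "x \<lhd>' y" "0 < \<epsilon>"
  shows "\<exists>c. x \<le> c \<and> c \<le> y + \<epsilon> *\<^sub>R 1 \<and> c \<lhd>' c + \<epsilon> *\<^sub>R 1"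
proof -
  obtain a b where ab: "a \<lhd> b" "x \<le> e a" "e b \<le> y + \<epsilon> *\<^sub>R 1"
    using assms by (rule prox_closureE)
  obtain c where c: "a \<le> c" "c \<le> b" "c \<lhd> c + \<epsilon> *\<^sub>R 1"
    using ab(1) assms(2) by (rule ex_almost_reflexive_between)
  have "e a \<le> e c" "e c \<le> e b" using c by simp_all
  moreover have "e c \<lhd>' e c + \<epsilon> *\<^sub>R 1" using prox_imp_prox_closure[OF c(3)] by simp
  ultimately show ?thesis using ab(2,3) by (meson order.trans)
qed

lemma almost_reflexive_refine:
  assumes "x \<lhd>' y" "0 < \<epsilon>" "x \<le> c" "c \<le> y + \<epsilon> *\<^sub>R 1" "c \<lhd>' c + \<epsilon> *\<^sub>R 1"
  shows "\<exists>d. (x \<le> d \<and> d \<le> y + (\<epsilon> / 2) *\<^sub>R 1 \<and> d \<lhd>' d + (\<epsilon> / 2) *\<^sub>R 1) \<and>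
    c \<le> d + (2 * \<epsilon>) *\<^sub>R 1 \<and> d \<le> c + (2 * \<epsilon>) *\<^sub>R 1"
proof -
  \<comment> \<open>These bounds cut the interval from x to y down to a neighbourhood of c, so that
    whatever is interpolated between them stays close to c.\<close>
  define p q where "p = sup x (c + (- 2 * \<epsilon>) *\<^sub>R 1)" and "q = inf y (c + \<epsilon> *\<^sub>R 1)"
  have "0 \<le> (2 * \<epsilon>) *\<^sub>R (1::'d)"
    using assms(2) by (intro ell_scaleR_nonneg bal_one_nonneg) auto
  then have "c + (- 2 * \<epsilon>) *\<^sub>R 1 \<le> c" by simp
  then have "c + (- 2 * \<epsilon>) *\<^sub>R 1 \<lhd>' c + \<epsilon> *\<^sub>R 1"
    using assms(5) order.refl by (rule prox_closure_mono)
  moreover have "c + (- 2 * \<epsilon>) *\<^sub>R 1 \<lhd>' y"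
  proof (rule prox_closure_mono[OF order.refl prox_closure_add_scalar[OF assms(5)]])
    have "c + \<epsilon> *\<^sub>R 1 + (- 2 * \<epsilon>) *\<^sub>R 1 = c + (- \<epsilon>) *\<^sub>R 1"
      by (simp add: scaleR_left_distrib[symmetric] add.assoc del: scaleR_minus_left)
    also have "\<dots> \<le> y" using assms(4) by (simp add: diff_le_eq)
    finally show "c + \<epsilon> *\<^sub>R 1 + (- 2 * \<epsilon>) *\<^sub>R 1 \<le> y" .
  qed
  \<comment> \<open>Four relations are needed, one for each joinand of \<open>p\<close> and each
    meetand of \<open>q\<close>. Besides the two just shown these are \<open>x \<lhd>' y\<close> and
    x \<le> c with \<open>c \<lhd>' c + \<epsilon> *\<^sub>R 1\<close>.\<close>
  ultimately have "p \<lhd>' q"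
    unfolding p_def q_def using assms(1,3,5)
    by (intro prox_closure_sup prox_closure_inf)
      (auto intro: prox_closure_mono simp del: mult_minus_left)
  moreover have "0 < \<epsilon> / 2" using assms(2) by simp
  ultimately obtain d where d: "p \<le> d" "d \<le> q + (\<epsilon> / 2) *\<^sub>R 1" "d \<lhd>' d + (\<epsilon> / 2) *\<^sub>R 1"
    using ex_almost_reflexive_closure by blast
  have "x \<le> d" "c + (- 2 * \<epsilon>) *\<^sub>R 1 \<le> d" using d(1) by (simp_all add: p_def)
  moreover from this have "c \<le> d + (2 * \<epsilon>) *\<^sub>R 1" by (simp add: diff_le_eq)
  moreover have "d \<le> y + (\<epsilon> / 2) *\<^sub>R 1" "d \<le> c + \<epsilon> *\<^sub>R 1 + (\<epsilon> / 2) *\<^sub>R 1"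
    using d(2) by (simp_all add: q_def add_inf_distrib_right)
  moreover have "d \<le> c + (2 * \<epsilon>) *\<^sub>R 1"
    by (rule bal_le_add_trans[OF \<open>d \<le> c + \<epsilon> *\<^sub>R 1 + (\<epsilon> / 2) *\<^sub>R 1\<close> order.refl])
      (use assms(2) in simp)
  ultimately show ?thesis using d(3) by blast
qed

lemma ex_reflexive_between:
  assumes "x \<lhd>' y"
  obtains c where "x \<le> c" "c \<le> y" "c \<lhd>' c"
proof -
  define \<epsilon> :: "nat \<Rightarrow> real" where "\<epsilon> n = (1 / 2) ^ n" for n
  have \<epsilon>: "0 < \<epsilon> n" "\<epsilon> (Suc n) = \<epsilon> n / 2" for n by (simp_all add: \<epsilon>_def)
  have "\<exists>f. \<forall>n. (x \<le> f n \<and> f n \<le> y + \<epsilon> n *\<^sub>R 1 \<and> f n \<lhd>' f n + \<epsilon> n *\<^sub>R 1) \<and>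
      (f n \<le> f (Suc n) + (2 * \<epsilon> n) *\<^sub>R 1 \<and> f (Suc n) \<le> f n + (2 * \<epsilon> n) *\<^sub>R 1)"
    by (rule dependent_nat_choice)
      (use ex_almost_reflexive_closure[OF assms \<epsilon>(1)] almost_reflexive_refine[OF assms \<epsilon>(1)]
        in \<open>simp_all add: \<epsilon>(2)\<close>)
  then obtain f where f: "\<And>n. x \<le> f n" "\<And>n. f n \<le> y + \<epsilon> n *\<^sub>R 1" "\<And>n. f n \<lhd>' f n + \<epsilon> n *\<^sub>R 1"
    and f_step: "\<And>n. f n \<le> f (Suc n) + (2 * \<epsilon> n) *\<^sub>R 1" "\<And>n. f (Suc n) \<le> f n + (2 * \<epsilon> n) *\<^sub>R 1"
    by blast
  \<comment> \<open>As \<epsilon> halves at each step, the step size \<open>2 * \<epsilon> k\<close>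
    equals \<open>4 * \<epsilon> k - 4 * \<epsilon> (Suc k)\<close>, and the sum telescopes. Keeping
    the exact difference makes the induction go through.\<close>
  have Cauchy: "f m \<le> f n + (4 * \<epsilon> n - 4 * \<epsilon> m) *\<^sub>R 1 \<and> f n \<le> f m + (4 * \<epsilon> n - 4 * \<epsilon> m) *\<^sub>R 1"
    if "n \<le> m" for m n
    using that
  proof (induction rule: dec_induct)
    case (step m)
    have "f (Suc m) \<le> f n + (4 * \<epsilon> n - 4 * \<epsilon> (Suc m)) *\<^sub>R 1"
      by (rule bal_le_add_trans[OF f_step(2)]) (use step.IH in \<open>auto simp: \<epsilon>(2)\<close>)
    moreover have "f n \<le> f (Suc m) + (4 * \<epsilon> n - 4 * \<epsilon> (Suc m)) *\<^sub>R 1"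
      by (rule bal_le_add_trans[OF _ f_step(1)]) (use step.IH in \<open>auto simp: \<epsilon>(2)\<close>)
    ultimately show ?case ..
  qed simp
  have "f m \<le> f n + (4 * \<epsilon> n) *\<^sub>R 1 \<and> f n \<le> f m + (4 * \<epsilon> n) *\<^sub>R 1" if "n \<le> m" for m n
  proof -
    have "(4 * \<epsilon> n - 4 * \<epsilon> m) *\<^sub>R 1 \<le> (4 * \<epsilon> n) *\<^sub>R (1::'d)"
      using \<epsilon>(1)[of m] by (intro bal_scaleR_one_mono) simp
    with Cauchy[OF that] show ?thesis by (meson add_left_mono order.trans)
  qed
  then obtain c where c: "\<And>n. c \<le> f n + (4 * \<epsilon> n) *\<^sub>R 1" "\<And>n. f n \<le> c + (4 * \<epsilon> n) *\<^sub>R 1"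
    using dedekind_Cauchy_limit[of f "\<lambda>n. 4 * \<epsilon> n"] by metis
  \<comment> \<open>The factor 9 is 4 + 1 + 4: from c up to \<open>f n\<close>, the reflexivity
    error of \<open>f n\<close>, and back from \<open>f n\<close> to c.\<close>
  have small: "\<exists>n. 9 * \<epsilon> n < \<delta>" if "0 < \<delta>" for \<delta>
  proof -
    have "0 < \<delta> / 9" "1 / 2 < (1::real)" using that by simp_all
    then obtain n where "\<epsilon> n < \<delta> / 9" unfolding \<epsilon>_def by (rule real_arch_pow_inv[THEN exE])
    then have "9 * \<epsilon> n < \<delta>" by simp
    then show ?thesis ..
  qed
  have "x \<le> c"
  proof (rule bal_le_epsilon)
    fix \<delta> :: real assume "0 < \<delta>"
    then obtain n where "9 * \<epsilon> n < \<delta>" using small by blast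
    then have "(4 * \<epsilon> n) *\<^sub>R 1 \<le> \<delta> *\<^sub>R (1::'d)"
      using \<epsilon>(1)[of n] by (intro bal_scaleR_one_mono) simp
    with f(1)[of n] c(2)[of n] show "x \<le> c + \<delta> *\<^sub>R 1"
      by (meson add_left_mono order.trans)
  qed
  moreover have "c \<le> y"
  proof (rule bal_le_epsilon)
    fix \<delta> :: real assume "0 < \<delta>"
    then obtain n where "9 * \<epsilon> n < \<delta>" using small by blast
    then show "c \<le> y + \<delta> *\<^sub>R 1"
      using \<epsilon>(1)[of n] by (intro bal_le_add_trans[OF c(1)[of n] f(2)]) simp
  qed
  moreover have "c \<lhd>' c"
  proof (rule prox_closure_epsilon)
    fix \<delta> :: real assume "0 < \<delta>"
    then obtain n where n: "9 * \<epsilon> n < \<delta>" using small by blast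
    show "c \<lhd>' c + \<delta> *\<^sub>R 1"
    proof (rule prox_closure_mono[OF c(1)[of n] prox_closure_add_scalar[OF f(3)]])
      have "f n + (\<epsilon> n + 4 * \<epsilon> n) *\<^sub>R 1 \<le> c + \<delta> *\<^sub>R 1"
        by (rule bal_le_add_trans[OF order.refl c(2)]) (use n in simp)
      then show "f n + \<epsilon> n *\<^sub>R 1 + (4 * \<epsilon> n) *\<^sub>R 1 \<le> c + \<delta> *\<^sub>R 1"
        by (simp only: scaleR_left_distrib add.assoc)
    qed
  qed
  ultimately show thesis using that by blast
qed

lemma KT_proximity_closure: "KT_proximity (closure_prox e prox)"
proof
  show "0 \<lhd>' 0" "1 \<lhd>' 1"
    using prox_closure_scalar[of 0] prox_closure_scalar[of 1] by simp_all
  \<comment> \<open>For reflexive c with x \<le> c \<le> y, monotonicity yields both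
    \<open>x \<lhd>' c\<close> and \<open>c \<lhd>' y\<close>. The same c then serves for
    (P9).\<close>
  show KT: "\<exists>c. c \<lhd>' c \<and> x \<lhd>' c \<and> c \<lhd>' y" if "x \<lhd>' y" for x y
    using that by (meson ex_reflexive_between order.refl prox_closure_mono)
  then show "\<exists>c. x \<lhd>' c \<and> c \<lhd>' y" if "x \<lhd>' y" for x y
    using that by blast
qed (fact prox_closure_le prox_closure_mono prox_closure_inf prox_closure_minus prox_closure_add
    prox_closure_scaleR ex_prox_closure_below | (rule prox_closure_mult; assumption))+

end

theorem theorem4p14:
  fixes prox :: "'s::bal_algebra \<Rightarrow> 's \<Rightarrow> bool"
    and e :: "'s \<Rightarrow> 'd::dedekind_algebra"
  assumes "proximity prox"
    and "dedekind_completion e"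
    and "uniformly_dense (range e)"
  shows "KT_proximity (closure_prox e prox) \<and> KT_algebra (closure_prox e prox)"
proof -
  interpret proximity prox by (fact assms(1))
  interpret dense_proximity prox e
    by standard (use assms in \<open>auto simp: dedekind_completion_def\<close>)
  have "closedin (prod_topology norm_topology norm_topology) {(x, y). closure_prox e prox x y}"
    unfolding closure_prox_def by simp
  with KT_proximity_closure show ?thesis by (simp add: KT_algebra_def)
qed

end
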